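(* Let $\mathbf{u}\in\ker f(A)^{\bar\ell}$ be a nonzero vector with $\operatorname{rank}_f\mathbf{u}=\ell$. Then, for each $i=1,2,\ldots,d$, $$\{\mathbf{p}^{(\ell)}(\alpha_i,\mathbf{u}),\ \mathbf{p}^{(\ell-1)}(\alpha_i,\mathbf{u}),\ \ldots,\ \mathbf{p}^{(1)}(\alpha_i,\mathbf{u})\}$$ is a Jordan chain of length $\ell$ of $A$ associated to the eigenvalue $\alpha_i$.
   Context: Let $K\subset\mathbb{C}$ be a subfield, $A$ an $n\times n$ matrix over $K$, $E$ the identity matrix of order $n$, and $f(\lambda)\in K[\lambda]$ a monic irreducible factor, of degree $d$, of the characteristic polynomial $\chi_A(\lambda)$. Let $\alpha_1,\ldots,\alpha_d\in\mathbb{C}$ be the roots of $f$, and let $\bar\ell$ be the multiplicity of $f$ in the minimal polynomial of $A$. For $1\le\ell\le\bar\ell$, $\ker f(A)^\ell=\{\mathbf{u}\in K^n\mid f(A)^\ell\mathbf{u}=\mathbf{0}\}$, and $\ker f(A)^0=\{\mathbf{0}\}$. For nonzero $\mathbf{u}\in\ker f(A)^{\bar\ell}$, $\operatorname{rank}_f\mathbf{u}=\ell$ means $\mathbf{u}\in\ker f(A)^\ell\setminus\ker f(A)^{\ell-1}$. Let $\psi_f(\mu,\lambda)=\dfrac{f(\mu)-f(\lambda)}{\mu-\lambda}\in K[\mu,\lambda]$. For $1\le k\le\bar\ell$, $\psi_f^{(k)}(\mu,\lambda)$ is obtained from $(\psi_f(\mu,\lambda))^k$, viewed as a polynomial in $\mu$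 with coefficients in $K[\lambda]$, by replacing each coefficient with its remainder on division by $f(\lambda)$. For $\mathbf{u}$ with $\operatorname{rank}_f\mathbf{u}=\ell$ and $1\le k\le\ell$, define $$\mathbf{p}^{(k)}(\lambda,\mathbf{u})=\psi_f^{(k)}(A,\lambda E)\,f(A)^{\ell-k}\mathbf{u}\in K[\lambda]^n,$$ where $\mu$ is replaced by $A$; $\mathbf{p}^{(k)}(\alpha_i,\mathbf{u})\in\mathbb{C}^n$ is its evaluation at $\lambda=\alpha_i$. A Jordan chain of length $\ell$ associated to $\alpha$ is a sequence $\mathbf{x}_\ell,\ldots,\mathbf{x}_1$ of vectors in $\mathbb{C}^n$ with $\mathbf{x}_1\neq\mathbf{0}$, $(A-\alpha E)\mathbf{x}_1=\mathbf{0}$ and $(A-\alpha E)\mathbf{x}_k=\mathbf{x}_{k-1}$ for $2\le k\le\ell$. *)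

theory Defs
  imports
    "Jordan_Normal_Form.Char_Poly"
    "Jordan_Normal_Form.Matrix_Kernel"
begin

(* p(A).  The type class is only comm_ring_1 because A is also taken over K[\<lambda>] below. *)
definition poly_mat :: "'a::comm_ring_1 poly \<Rightarrow> 'a mat \<Rightarrow> 'a mat" where
  "poly_mat p A =
     mat (dim_row A) (dim_row A)
       (\<lambda>(i, j). \<Sum>k\<le>degree p. coeff p k * (A ^\<^sub>m k) $$ (i, j))"

definition minimal_poly :: "'a::field mat \<Rightarrow> 'a poly" where
  "minimal_poly A =
     (THE m. lead_coeff m = 1 \<and> poly_mat m A = 0\<^sub>m (dim_row A) (dim_row A) \<and>
        (\<forall>q. q \<noteq> 0 \<and> poly_mat q A = 0\<^sub>m (dim_row A) (dim_row A) \<longrightarrow> degree m \<le> degree q))"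

(* The library's multiplicity, unfolded: the constant itself would demand more than class field
   of the coefficients. *)
definition min_mult :: "'a::field poly \<Rightarrow> 'a mat \<Rightarrow> nat" where
  "min_mult f A = Max {k. f ^ k dvd minimal_poly A}"

definition has_rank :: "'a::field poly \<Rightarrow> 'a mat \<Rightarrow> 'a vec \<Rightarrow> nat \<Rightarrow> bool" where
  "has_rank f A u l \<longleftrightarrow>
     1 \<le> l \<and> l \<le> min_mult f A \<and>
     u \<in> mat_kernel (poly_mat f A ^\<^sub>m l) - mat_kernel (poly_mat f A ^\<^sub>m (l - 1))"

(* K[\<mu>,\<lambda>] is rendered as 'a poly poly: the outer variable is \<mu>, the coefficients lie in K[\<lambda>].
   Hence f(\<mu>) is map_poly (\<lambda>c. [:c:]) f, f(\<lambda>) is [:f:], and \<mu> - \<lambda> is [:- [:0, 1:], 1:].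
   The division is exact, see psi_mult. *)
definition psi :: "'a::field poly \<Rightarrow> 'a poly poly" where
  "psi f = (map_poly (\<lambda>c. [:c:]) f - [:f:]) div [:- [:0, 1:], 1:]"

lemma psi_mult: "psi f * [:- [:0, 1:], 1:] = map_poly (\<lambda>c. [:c:]) f - [:f:]"
proof -
  have "poly (map_poly (\<lambda>c. [:c:]) f) [:0, 1:] = f"
    by (induction f) (auto simp: map_poly_pCons)
  then have "[:- [:0, 1:], 1:] dvd map_poly (\<lambda>c. [:c:]) f - [:f:]"
    by (subst poly_eq_0_iff_dvd[symmetric]) simp
  then show ?thesis
    unfolding psi_def by (rule dvd_div_mult_self)
qed

definition psi_pow :: "'a::field poly \<Rightarrow> nat \<Rightarrow> 'a poly poly" where
  "psi_pow f k = map_poly (\<lambda>c. c mod f) (psi f ^ k)"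

(* p^(k)(\<lambda>, u) for u of rank l, as a vector over K[\<lambda>]; A and f(A)^(l-k) u are
   embedded into K[\<lambda>] as constants. *)
definition p_vec :: "'a::field poly \<Rightarrow> 'a mat \<Rightarrow> nat \<Rightarrow> nat \<Rightarrow> 'a vec \<Rightarrow> 'a poly vec" where
  "p_vec f A l k u =
     poly_mat (psi_pow f k) (map_mat (\<lambda>a. [:a:]) A) *\<^sub>v
       map_vec (\<lambda>a. [:a:]) ((poly_mat f A ^\<^sub>m (l - k)) *\<^sub>v u)"

definition eval_vec :: "('a::field \<Rightarrow> complex) \<Rightarrow> 'a poly vec \<Rightarrow> complex \<Rightarrow> complex vec" where
  "eval_vec h v z = map_vec (\<lambda>q. poly (map_poly h q) z) v"

(* The chain x_l, ..., x_1 is given by its indexing function; only x 1, ..., x l matter. *)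
definition jordan_chain :: "complex mat \<Rightarrow> complex \<Rightarrow> nat \<Rightarrow> (nat \<Rightarrow> complex vec) \<Rightarrow> bool" where
  "jordan_chain B z l x \<longleftrightarrow>
     1 \<le> l \<and> (\<forall>k\<in>{1..l}. x k \<in> carrier_vec (dim_row B)) \<and>
     x 1 \<noteq> 0\<^sub>v (dim_row B) \<and>
     (B - z \<cdot>\<^sub>m 1\<^sub>m (dim_row B)) *\<^sub>v x 1 = 0\<^sub>v (dim_row B) \<and>
     (\<forall>k\<in>{2..l}. (B - z \<cdot>\<^sub>m 1\<^sub>m (dim_row B)) *\<^sub>v x k = x (k - 1))"

end

theory Submission
  imports Defs
begin

text \<open>Evaluating \<open>\<lambda>\<close> at a root \<open>\<alpha>\<close> of \<open>f\<close> makes the reductions modulo \<open>f\<close> invisible and turns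
  \<open>\<psi>\<^sub>f(\<mu>, \<lambda>)\<close> into \<open>g(\<mu>) = f(\<mu>) / (\<mu> - \<alpha>)\<close>. Hence the \<open>k\<close>-th vector is \<open>g(A)\<^sup>k f(A)\<^sup>l\<^sup>-\<^sup>k u\<close>, and
  multiplying it by \<open>A - \<alpha>E\<close> trades one factor \<open>g(A)\<close> for a factor \<open>f(A)\<close>. The first vector
  is nonzero because, for \<open>w = f(A)\<^sup>l\<^sup>-\<^sup>1 u\<close>, the entries of \<open>\<psi>\<^sub>f(A, \<lambda>E) w\<close> are polynomials in \<open>\<lambda>\<close>
  of degree less than \<open>d = deg f\<close> whose coefficients of \<open>\<lambda>\<^sup>d\<^sup>-\<^sup>1\<close> are the entries of \<open>w\<close>; if they
  all vanished at \<open>\<alpha>\<close>, irreducibility of \<open>f\<close> would make them zero, and so \<open>w = 0\<close>.\<close>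

section \<open>Polynomials in a matrix\<close>

lemma poly_mat_carrier [simp]:
  "A \<in> carrier_mat n n \<Longrightarrow> poly_mat p A \<in> carrier_mat n n"
  by (auto simp: poly_mat_def)

lemma poly_mat_dim [simp]:
  "dim_row (poly_mat p A) = dim_row A" "dim_col (poly_mat p A) = dim_row A"
  by (simp_all add: poly_mat_def)

text \<open>Terms beyond the degree vanish. The free bound \<open>N\<close> lets polynomials of
  different degrees be expanded over one common range.\<close>

lemma poly_mat_index:
  assumes "A \<in> carrier_mat n n" "i < n" "j < n" "degree p \<le> N"
  shows "poly_mat p A $$ (i, j) = (\<Sum>k\<le>N. coeff p k * (A ^\<^sub>m k) $$ (i, j))"
proof -
  have "(\<Sum>k\<le>degree p. coeff p k * (A ^\<^sub>m k) $$ (i, j)) =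
      (\<Sum>k\<le>N. coeff p k * (A ^\<^sub>m k) $$ (i, j))"
    by (rule sum.mono_neutral_left) (use assms(4) in \<open>auto simp: coeff_eq_0\<close>)
  then show ?thesis
    using assms by (simp add: poly_mat_def)
qed

lemma poly_mat_0: "A \<in> carrier_mat n n \<Longrightarrow> poly_mat 0 A = 0\<^sub>m n n"
  by (rule eq_matI) (auto simp: poly_mat_def)

text \<open>Horner's rule, which opens the way to induction over polynomials. \<open>A\<close>
  stands on the right because \<open>^\<^sub>m\<close> appends its factors there.\<close>

lemma poly_mat_pCons:
  assumes A: "A \<in> carrier_mat n n"
  shows "poly_mat (pCons a p) A = a \<cdot>\<^sub>m 1\<^sub>m n + poly_mat p A * A"
proof (rule eq_matI)
  fix i j
  assume "i < dim_row (a \<cdot>\<^sub>m 1\<^sub>m n + poly_mat p A * A)" "j < dim_col (a \<cdot>\<^sub>m 1\<^sub>m n + poly_mat p A * A)"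
  then have ij: "i < n" "j < n"
    using A by auto
  have pow: "(A ^\<^sub>m Suc k) $$ (i, j) = (\<Sum>t<n. (A ^\<^sub>m k) $$ (i, t) * A $$ (t, j))" for k
  proof -
    have "A ^\<^sub>m k \<in> carrier_mat n n"
      using A by simp
    then show ?thesis
      using A ij by (auto simp: scalar_prod_def atLeast0LessThan intro!: sum.cong)
  qed
  \<comment> \<open>The bound \<open>Suc (degree p)\<close> also covers \<open>p = 0\<close>, where
    \<open>pCons a p\<close> has degree 0.\<close>
  have "poly_mat (pCons a p) A $$ (i, j) =
      (\<Sum>k\<le>Suc (degree p). coeff (pCons a p) k * (A ^\<^sub>m k) $$ (i, j))"
    by (rule poly_mat_index[OF A ij]) (simp add: degree_pCons_le)
  also have "\<dots> = a * 1\<^sub>m n $$ (i, j) + (\<Sum>k\<le>degree p. coeff p k * (A ^\<^sub>m Suc k) $$ (i, j))"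
    using A by (subst sum.atMost_Suc_shift) simp
  also have "(\<Sum>k\<le>degree p. coeff p k * (A ^\<^sub>m Suc k) $$ (i, j)) =
      (\<Sum>t<n. \<Sum>k\<le>degree p. coeff p k * (A ^\<^sub>m k) $$ (i, t) * A $$ (t, j))"
    unfolding pow sum_distrib_left by (subst sum.swap) (simp add: mult.assoc)
  also have "\<dots> = (\<Sum>t<n. poly_mat p A $$ (i, t) * A $$ (t, j))"
    using A ij by (intro sum.cong refl) (simp add: poly_mat_index[OF A _ _ order_refl] sum_distrib_right)
  also have "\<dots> = (poly_mat p A * A) $$ (i, j)"
    using A ij poly_mat_carrier[OF A, of p]
    by (auto simp: scalar_prod_def atLeast0LessThan intro!: sum.cong)
  finally show "poly_mat (pCons a p) A $$ (i, j) = (a \<cdot>\<^sub>m 1\<^sub>m n + poly_mat p A * A) $$ (i, j)"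
    using A ij poly_mat_carrier[OF A, of p] by simp
qed (use A poly_mat_carrier[OF A, of "pCons a p"] in auto)

lemma poly_mat_1: "A \<in> carrier_mat n n \<Longrightarrow> poly_mat 1 A = 1\<^sub>m n"
  by (simp add: one_pCons poly_mat_pCons poly_mat_0)
     (rule eq_matI, auto)

lemma poly_mat_linear:
  assumes A: "A \<in> carrier_mat n n"
  shows "poly_mat [:- z, 1:] A = A - z \<cdot>\<^sub>m 1\<^sub>m n"
proof -
  have "poly_mat [:- z, 1:] A = - z \<cdot>\<^sub>m 1\<^sub>m n + A"
    using A by (simp add: poly_mat_pCons[OF A, of "- z"] poly_mat_1 flip: one_pCons)
  then show ?thesis
    using A by (auto intro!: eq_matI)
qed

lemma poly_mat_add:
  assumes A: "A \<in> carrier_mat n n"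
  shows "poly_mat (p + q) A = poly_mat p A + poly_mat q A"
proof (rule eq_matI)
  fix i j
  assume "i < dim_row (poly_mat p A + poly_mat q A)" "j < dim_col (poly_mat p A + poly_mat q A)"
  then have ij: "i < n" "j < n"
    using A poly_mat_carrier[OF A, of q] by auto
  let ?N = "max (degree p) (degree q)"
  show "poly_mat (p + q) A $$ (i, j) = (poly_mat p A + poly_mat q A) $$ (i, j)"
    using ij A
    by (simp add: poly_mat_index[OF A ij, of _ ?N] degree_add_le_max distrib_right sum.distrib)
qed (use poly_mat_carrier[OF A, of "p + q"] poly_mat_carrier[OF A, of q] in auto)

lemma poly_mat_smult:
  assumes A: "A \<in> carrier_mat n n"
  shows "poly_mat (Polynomial.smult c p) A = c \<cdot>\<^sub>m poly_mat p A"
proof (rule eq_matI)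
  fix i j
  assume "i < dim_row (c \<cdot>\<^sub>m poly_mat p A)" "j < dim_col (c \<cdot>\<^sub>m poly_mat p A)"
  then have ij: "i < n" "j < n"
    using poly_mat_carrier[OF A, of p] by auto
  show "poly_mat (Polynomial.smult c p) A $$ (i, j) = (c \<cdot>\<^sub>m poly_mat p A) $$ (i, j)"
    using ij A
    by (simp add: poly_mat_index[OF A ij, of _ "degree p"] degree_smult_le sum_distrib_left mult.assoc)
qed (use poly_mat_carrier[OF A, of "Polynomial.smult c p"] poly_mat_carrier[OF A, of p] in auto)

text \<open>By Horner's rule on \<open>q\<close>, \<open>poly_mat p A\<close> only has to pass a
  scalar matrix, while \<open>A\<close> stays on the right. Polynomials in \<open>A\<close> thus
  inherit commutativity from the polynomial ring.\<close>

lemma poly_mat_mult: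
  assumes A: "A \<in> carrier_mat n n"
  shows "poly_mat (p * q) A = poly_mat p A * poly_mat q A"
proof (induction q)
  case 0
  then show ?case
    using right_mult_zero_mat[OF poly_mat_carrier[OF A], of p n] by (simp add: poly_mat_0[OF A])
next
  case (pCons a q)
  note [simp] = poly_mat_carrier[OF A] A
  have zero: "0 \<cdot>\<^sub>m 1\<^sub>m n = (0\<^sub>m n n :: 'a mat)"
    by (rule eq_matI) auto
  have "poly_mat (p * pCons a q) A = a \<cdot>\<^sub>m poly_mat p A + poly_mat (pCons 0 (p * q)) A"
    by (simp add: poly_mat_add[OF A] poly_mat_smult[OF A])
  also have "poly_mat (pCons 0 (p * q)) A = poly_mat (p * q) A * A"
    unfolding poly_mat_pCons[OF A]
    by (simp add: zero left_add_zero_mat[of _ n n] mult_carrier_mat[of _ n n _ n])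
  also have "\<dots> = poly_mat p A * (poly_mat q A * A)"
    unfolding pCons.IH by (rule assoc_mult_mat) auto
  also have "a \<cdot>\<^sub>m poly_mat p A = poly_mat p A * (a \<cdot>\<^sub>m 1\<^sub>m n)"
    using mult_smult_distrib[of "poly_mat p A" n n "1\<^sub>m n" n a]
    by (simp add: right_mult_one_mat[of _ n n])
  also have "poly_mat p A * (a \<cdot>\<^sub>m 1\<^sub>m n) + poly_mat p A * (poly_mat q A * A) =
      poly_mat p A * (a \<cdot>\<^sub>m 1\<^sub>m n + poly_mat q A * A)"
    by (rule mult_add_distrib_mat[symmetric, of _ n n _ n]) (auto intro: mult_carrier_mat[of _ n n _ n])
  finally show ?case
    unfolding poly_mat_pCons[OF A] .
qed

lemma poly_mat_power:
  "A \<in> carrier_mat n n \<Longrightarrow> poly_mat (p ^ m) A = poly_mat p A ^\<^sub>m m"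
  by (induction m)
     (auto simp: poly_mat_1 poly_mat_mult mult.commute[of p] dest: poly_mat_carrier[of A n p])

lemma poly_mat_mult_vec:
  assumes "A \<in> carrier_mat n n" "v \<in> carrier_vec n"
  shows "poly_mat p A *\<^sub>v (poly_mat q A *\<^sub>v v) = poly_mat (p * q) A *\<^sub>v v"
  using assms by (simp add: poly_mat_mult assoc_mult_mat_vec[of _ n n _ n])

text \<open>Serves for two homomorphisms: the embedding of K into the larger field and the
  evaluation of K[\<lambda>] at a point of that field.\<close>

lemma (in comm_ring_hom) mat_hom_poly_mat:
  assumes A: "A \<in> carrier_mat n n"
  shows "mat\<^sub>h (poly_mat p A) = poly_mat (map_poly hom p) (mat\<^sub>h A)"
proof (rule eq_matI)
  fix i j
  assume "i < dim_row (poly_mat (map_poly hom p) (mat\<^sub>h A))"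
    "j < dim_col (poly_mat (map_poly hom p) (mat\<^sub>h A))"
  then have ij: "i < n" "j < n"
    using A by (auto simp: poly_mat_def)
  have pow: "(mat\<^sub>h A ^\<^sub>m k) $$ (i, j) = hom ((A ^\<^sub>m k) $$ (i, j))" for k
    using ij A by (simp flip: mat_hom_pow[OF A])
  show "mat\<^sub>h (poly_mat p A) $$ (i, j) = poly_mat (map_poly hom p) (mat\<^sub>h A) $$ (i, j)"
    using A ij poly_mat_carrier[OF A, of p]
    by (simp add: poly_mat_index[where n = n and N = "degree p"] degree_map_poly_le pow hom_distribs)
qed (use A in \<open>auto simp: poly_mat_def\<close>)

section \<open>The coefficients of \<open>\<psi>\<^sub>f\<close>\<close>

text \<open>Compare the coefficients of \<mu>^i \<lambda>^(m+1) in \<open>psi_mult\<close>. For i =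
  0 only f(\<lambda>) contributes on the right; for i > 0 nothing does, so the coefficient at (i, m)
  equals the one at (i-1, m+1).\<close>

lemma coeff_psi: "coeff (coeff (psi f) i) m = coeff f (Suc (i + m))"
proof (induction i arbitrary: m)
  case 0
  have "coeff (coeff (psi f * [:- [:0, 1:], 1:]) 0) (Suc m) =
      coeff (coeff (map_poly (\<lambda>c. [:c:]) f - [:f:]) 0) (Suc m)"
    by (simp only: psi_mult)
  then show ?case
    by (simp add: coeff_map_poly)
next
  case (Suc i)
  have "coeff (coeff (psi f * [:- [:0, 1:], 1:]) (Suc i)) (Suc m) =
      coeff (coeff (map_poly (\<lambda>c. [:c:]) f - [:f:]) (Suc i)) (Suc m)"
    by (simp only: psi_mult)
  then have "coeff (coeff (psi f) (Suc i)) m = coeff (coeff (psi f) i) (Suc m)"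
    by (simp add: coeff_map_poly)
  then show ?case
    by (simp add: Suc.IH)
qed

text \<open>Let \<open>m\<close> be a nonzero polynomial of least degree vanishing at
  \<open>z\<close>. Division with remainder shows that \<open>m\<close> divides \<open>f\<close>; it
  is no unit, since nonzero constants do not vanish, so \<open>f\<close> is \<open>m\<close> up to a
  unit.\<close>

lemma (in field_hom) irreducible_root_degree:
  assumes "irreducible f" "poly (map_poly hom f) z = 0"
    and "q \<noteq> 0" "poly (map_poly hom q) z = 0"
  shows "degree f \<le> degree q"
proof -
  interpret P: map_poly_comm_ring_hom hom ..
  let ?S = "\<lambda>m. m \<noteq> 0 \<and> poly (map_poly hom m) z = 0"
  obtain m where m: "?S m" and min: "\<And>r. ?S r \<Longrightarrow> degree m \<le> degree r"
    using assms(3,4) ex_has_least_nat[of ?S q degree] by blast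
  have "poly (map_poly hom (f mod m)) z = poly (map_poly hom (f - f div m * m)) z"
    by (simp add: minus_div_mult_eq_mod)
  also have "\<dots> = 0"
    using m assms(2) by (simp add: P.hom_minus P.hom_mult)
  finally have "f mod m = 0"
    using min[of "f mod m"] degree_mod_less'[of m f] m by fastforce
  then obtain c where c: "f = m * c"
    by (metis dvdE mod_0_imp_dvd)
  have "\<not> m dvd 1"
  proof
    assume "m dvd 1"
    then obtain a where "m = [:a:]" "a \<noteq> 0"
      using m by (auto simp: poly_dvd_1 elim: degree_eq_zeroE)
    then show False
      using m by simp
  qed
  then have "c dvd 1"
    using irreducibleD[OF assms(1) c] by blast
  then have "degree f = degree m"
    using c m by (metis degree_mult_eq degree_0 add_0_right mult_zero_right poly_dvd_1
        assms(1) not_irreducible_zero)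
  then show ?thesis
    using min[of q] assms(3,4) by simp
qed

lemma const_poly_hom: "comm_ring_hom (\<lambda>a :: 'a :: comm_ring_1. [:a:])"
  by unfold_locales (auto simp: one_pCons)

section \<open>Evaluation at a root\<close>

context field_hom
begin

lemma eval_comm_ring_hom: "comm_ring_hom (\<lambda>q. poly (map_poly hom q) z)"
proof -
  interpret P: map_poly_comm_ring_hom hom ..
  show ?thesis
    by unfold_locales (auto simp: P.hom_add P.hom_mult)
qed

text \<open>At a root \<open>z\<close> of \<open>f\<close> this is the quotient g of the
  overview.\<close>

abbreviation psi_at :: "'a poly \<Rightarrow> 'b \<Rightarrow> 'b poly" where
  "psi_at f z \<equiv> map_poly (\<lambda>q. poly (map_poly hom q) z) (psi f)"

lemma psi_at_mult:
  assumes "poly (map_poly hom f) z = 0"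
  shows "[:- z, 1:] * psi_at f z = map_poly hom f"
proof -
  interpret ev: comm_ring_hom "\<lambda>q. poly (map_poly hom q) z"
    by (rule eval_comm_ring_hom)
  interpret E: map_poly_comm_ring_hom "\<lambda>q. poly (map_poly hom q) z" ..
  have "psi_at f z * map_poly (\<lambda>q. poly (map_poly hom q) z) [:- [:0, 1:], 1:] =
      map_poly (\<lambda>q. poly (map_poly hom q) z) (map_poly (\<lambda>c. [:c:]) f - [:f:])"
    by (simp only: psi_mult flip: E.hom_mult)
  also have "\<dots> = map_poly (\<lambda>q. poly (map_poly hom q) z) (map_poly (\<lambda>c. [:c:]) f)"
    using assms by (simp add: E.hom_minus ev.map_poly_pCons_hom)
  also have "\<dots> = map_poly hom f"
    by (rule poly_eqI) (simp add: coeff_map_poly map_poly_pCons_hom)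
  finally show ?thesis
    by (simp add: hom_distribs mult.commute)
qed

text \<open>Reduction modulo \<open>f\<close> changes a coefficient by a multiple of
  \<open>f\<close>, which vanishes at \<open>z\<close>.\<close>

lemma map_poly_eval_psi_pow:
  assumes "poly (map_poly hom f) z = 0"
  shows "map_poly (\<lambda>q. poly (map_poly hom q) z) (psi_pow f k) = psi_at f z ^ k"
proof -
  interpret P: map_poly_comm_ring_hom hom ..
  interpret ev: comm_ring_hom "\<lambda>q. poly (map_poly hom q) z"
    by (rule eval_comm_ring_hom)
  interpret E: map_poly_comm_ring_hom "\<lambda>q. poly (map_poly hom q) z" ..
  have mod: "poly (map_poly hom (c mod f)) z = poly (map_poly hom c) z" for c
  proof -
    have "poly (map_poly hom (c mod f)) z = poly (map_poly hom (c - c div f * f)) z"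
      by (simp add: minus_div_mult_eq_mod)
    then show ?thesis
      using assms by (simp add: P.hom_minus P.hom_mult)
  qed
  have "map_poly (\<lambda>q. poly (map_poly hom q) z) (psi_pow f k) =
      map_poly (\<lambda>q. poly (map_poly hom q) z) (psi f ^ k)"
    unfolding psi_pow_def by (rule poly_eqI) (simp add: coeff_map_poly mod)
  then show ?thesis
    by (simp add: E.hom_power)
qed

text \<open>Evaluation is a ring homomorphism that sends a constant to its image under
  \<open>hom\<close>. \<open>P\<close> stays general so that both \<open>psi_pow f k\<close> and
  \<open>psi f\<close> can be inserted.\<close>

lemma eval_poly_mat_const_vec:
  assumes A: "A \<in> carrier_mat n n" and v: "v \<in> carrier_vec n"
  shows "map_vec (\<lambda>q. poly (map_poly hom q) z)
      (poly_mat P (map_mat (\<lambda>a. [:a:]) A) *\<^sub>v map_vec (\<lambda>a. [:a:]) v) =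
    poly_mat (map_poly (\<lambda>q. poly (map_poly hom q) z) P) (map_mat hom A) *\<^sub>v map_vec hom v"
proof -
  interpret ev: comm_ring_hom "\<lambda>q. poly (map_poly hom q) z"
    by (rule eval_comm_ring_hom)
  have A': "map_mat (\<lambda>a. [:a:]) A \<in> carrier_mat n n" and v': "map_vec (\<lambda>a. [:a:]) v \<in> carrier_vec n"
    using A v by auto
  have "map_mat (\<lambda>q. poly (map_poly hom q) z) (map_mat (\<lambda>a. [:a:]) A) = map_mat hom A"
    and "map_vec (\<lambda>q. poly (map_poly hom q) z) (map_vec (\<lambda>a. [:a:]) v) = map_vec hom v"
    by (auto simp: map_poly_pCons_hom)
  then show ?thesis
    by (simp add: ev.mult_mat_vec_hom[OF poly_mat_carrier[OF A'] v'] ev.mat_hom_poly_mat[OF A'])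
qed

text \<open>The argument rests on \<open>w\<close> having entries in the small field: over the
  larger one, g(A) kills every eigenvector whose eigenvalue is a root of g.\<close>

lemma psi_at_mult_vec_eq_0:
  assumes A: "A \<in> carrier_mat n n" and w: "w \<in> carrier_vec n"
    and f: "irreducible f" "lead_coeff f = 1" "poly (map_poly hom f) z = 0"
    and zero: "poly_mat (psi_at f z) (map_mat hom A) *\<^sub>v map_vec hom w = 0\<^sub>v n"
  shows "w = 0\<^sub>v n"
proof (rule eq_vecI)
  interpret C: comm_ring_hom "\<lambda>a :: 'a. [:a:]"
    by (rule const_poly_hom)
  let ?A = "map_mat (\<lambda>a. [:a:]) A" and ?w = "map_vec (\<lambda>a. [:a:]) w"
  let ?v = "poly_mat (psi f) ?A *\<^sub>v ?w"
  have A': "?A \<in> carrier_mat n n"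
    using A by simp
  \<comment> \<open>Keeps the index \<open>degree f - 1\<close>, inspected below, from being
    truncated.\<close>
  have "degree f \<noteq> 0"
  proof
    assume "degree f = 0"
    then have "f = 1"
      using f(2) by (metis degree_eq_zeroE lead_coeff_pCons(2) one_pCons)
    then show False
      using f(3) by simp
  qed
  fix j
  assume "j < dim_vec (0\<^sub>v n :: 'a vec)"
  then have j: "j < n"
    by simp
  \<comment> \<open>\<open>a i\<close> is entry \<open>j\<close> of A^i w, the weight of the \<mu>^i
    coefficient of \<open>psi f\<close> in entry \<open>j\<close> of \<open>?v\<close>.\<close>
  define a where "a i = (\<Sum>t<n. (A ^\<^sub>m i) $$ (j, t) * w $ t)" for i
  have "?v $ j = (\<Sum>t<n. poly_mat (psi f) ?A $$ (j, t) * [:w $ t:])"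
    using j w poly_mat_carrier[OF A', of "psi f"]
    by (auto simp: scalar_prod_def atLeast0LessThan intro!: sum.cong)
  also have "\<dots> = (\<Sum>t<n. \<Sum>i\<le>degree (psi f). coeff (psi f) i * [:(A ^\<^sub>m i) $$ (j, t) * w $ t:])"
  proof (intro sum.cong refl)
    fix t
    assume "t \<in> {..<n}"
    then have "(?A ^\<^sub>m i) $$ (j, t) = [:(A ^\<^sub>m i) $$ (j, t):]" for i
      using A j by (simp flip: C.mat_hom_pow[OF A])
    then show "poly_mat (psi f) ?A $$ (j, t) * [:w $ t:] =
        (\<Sum>i\<le>degree (psi f). coeff (psi f) i * [:(A ^\<^sub>m i) $$ (j, t) * w $ t:])"
      using \<open>t \<in> {..<n}\<close> j
      by (simp add: poly_mat_index[OF A' _ _ order_refl] sum_distrib_right smult_sum2 mult_ac)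
  qed
  also have "\<dots> = (\<Sum>i\<le>degree (psi f). Polynomial.smult (a i) (coeff (psi f) i))"
    by (subst sum.swap) (simp add: a_def smult_sum)
  finally have v: "?v $ j = (\<Sum>i\<le>degree (psi f). Polynomial.smult (a i) (coeff (psi f) i))" .
  have coeff_v: "coeff (?v $ j) m = (\<Sum>i\<le>degree (psi f). a i * coeff f (Suc (i + m)))" for m
    by (simp add: v coeff_sum coeff_psi)
  \<comment> \<open>Once \<open>m\<close> reaches \<open>degree f\<close>, every index
    \<open>Suc (i + m)\<close> exceeds the degree.\<close>
  have "degree (?v $ j) < degree f"
    using \<open>degree f \<noteq> 0\<close> by (intro degree_lessI) (auto simp: coeff_v coeff_eq_0)
  moreover have "poly (map_poly hom (?v $ j)) z = 0"
  proof -
    have "map_vec (\<lambda>q. poly (map_poly hom q) z) ?v $ j = 0"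
      using j zero by (simp add: eval_poly_mat_const_vec[OF A w])
    then show ?thesis
      using j A by simp
  qed
  ultimately have "?v $ j = 0"
    using irreducible_root_degree[OF f(1,3)] by fastforce
  \<comment> \<open>Only \<open>i = 0\<close> stays within the degree of \<open>f\<close>, and there
    it meets the leading coefficient 1.\<close>
  moreover have "coeff (?v $ j) (degree f - 1) = a 0"
  proof -
    have "(\<Sum>i\<le>degree (psi f). a i * coeff f (Suc (i + (degree f - 1)))) =
        (\<Sum>i\<le>degree (psi f). if i = 0 then a 0 else 0)"
      using \<open>degree f \<noteq> 0\<close> f(2) by (intro sum.cong) (auto simp: coeff_eq_0)
    then show ?thesis
      by (simp add: coeff_v)
  qed
  moreover have "a 0 = w $ j"
    using A j by (simp add: a_def if_distrib[of "\<lambda>x. x * _"] cong: if_cong)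
  ultimately show "w $ j = 0\<^sub>v n $ j"
    using j by simp
qed (use w in simp)

end

text \<open>Merging both factors into one polynomial in the matrix turns the chain relations into
  polynomial identities.\<close>

lemma eval_p_vec:
  assumes "field_hom emb" and A: "A \<in> carrier_mat n n" and u: "u \<in> carrier_vec n"
    and z: "poly (map_poly emb f) z = 0"
  shows "eval_vec emb (p_vec f A l k u) z =
    poly_mat (field_hom.psi_at emb f z ^ k * map_poly emb f ^ (l - k)) (map_mat emb A) *\<^sub>v map_vec emb u"
proof -
  interpret field_hom emb by fact
  interpret P: map_poly_comm_ring_hom emb ..
  have w: "poly_mat f A ^\<^sub>m (l - k) *\<^sub>v u \<in> carrier_vec n"
    using A u by (metis mult_mat_vec_carrier poly_mat_carrier pow_carrier_mat)
  have "map_vec emb (poly_mat f A ^\<^sub>m (l - k) *\<^sub>v u) =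
      poly_mat (map_poly emb f ^ (l - k)) (map_mat emb A) *\<^sub>v map_vec emb u"
    using A by (simp add: mult_mat_vec_hom[OF poly_mat_carrier[OF A] u] mat_hom_poly_mat[OF A]
        P.hom_power flip: poly_mat_power)
  then show ?thesis
    unfolding p_vec_def eval_vec_def eval_poly_mat_const_vec[OF A w] map_poly_eval_psi_pow[OF z]
    using A u by (simp add: poly_mat_mult_vec[of _ n])
qed

section \<open>The Jordan chain at a fixed root of f\<close>

theorem theorem6:
  fixes emb :: "'k::field \<Rightarrow> complex"
    and A :: "'k mat" and n :: nat
    and f :: "'k poly" and \<alpha> :: "nat \<Rightarrow> complex"
    and u :: "'k vec" and l :: nat
  assumes "field_hom emb"
    and "A \<in> carrier_mat n n"
    and "lead_coeff f = 1" and "irreducible f" and "f dvd char_poly A"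
    and "\<alpha> ` {1..degree f} = {z. poly (map_poly emb f) z = 0}"
    and "u \<in> mat_kernel (poly_mat f A ^\<^sub>m min_mult f A)" and "u \<noteq> 0\<^sub>v n"
    and "has_rank f A u l"
  shows "\<forall>i\<in>{1..degree f}.
    jordan_chain (map_mat emb A) (\<alpha> i) l (\<lambda>k. eval_vec emb (p_vec f A l k u) (\<alpha> i))"
proof
  interpret field_hom emb by fact
  interpret P: map_poly_comm_ring_hom emb ..
  note A = assms(2)
  fix i
  assume "i \<in> {1..degree f}"
  then have z: "poly (map_poly emb f) (\<alpha> i) = 0"
    using assms(6) by blast
  let ?B = "map_mat emb A" and ?U = "map_vec emb u"
  let ?F = "map_poly emb f" and ?g = "psi_at f (\<alpha> i)"
  have B: "?B \<in> carrier_mat n n"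
    using A by simp
  have l: "1 \<le> l"
    using assms(9) by (simp add: has_rank_def)
  have fA: "poly_mat f A ^\<^sub>m m \<in> carrier_mat n n" for m
    using A by (intro pow_carrier_mat poly_mat_carrier)
  have u: "u \<in> carrier_vec n" and ul: "poly_mat (f ^ l) A *\<^sub>v u = 0\<^sub>v n"
    and ul1: "poly_mat (f ^ (l - 1)) A *\<^sub>v u \<noteq> 0\<^sub>v n"
    using assms(9) unfolding has_rank_def poly_mat_power[OF A] by (auto simp: mat_kernel[OF fA])
  have U: "?U \<in> carrier_vec n"
    using u by simp
  have hom_f: "poly_mat (?F ^ m) ?B *\<^sub>v ?U = map_vec emb (poly_mat (f ^ m) A *\<^sub>v u)" for m
    by (simp add: mult_mat_vec_hom[OF poly_mat_carrier[OF A] u] mat_hom_poly_mat[OF A] P.hom_power)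
  \<comment> \<open>The index 0, just below the chain, is included on purpose: \<open>x 0\<close> is
    f(A)^l u = 0, so the eigenvector equation becomes the case \<open>k = 1\<close> of
    \<open>step\<close>.\<close>
  define x where "x k = poly_mat (?g ^ k * ?F ^ (l - k)) ?B *\<^sub>v ?U" for k
  have x_carrier: "x k \<in> carrier_vec n" for k
    unfolding x_def by (rule mult_mat_vec_carrier[OF poly_mat_carrier[OF B] U])
  have step: "(?B - \<alpha> i \<cdot>\<^sub>m 1\<^sub>m n) *\<^sub>v x k = x (k - 1)" if "1 \<le> k" "k \<le> l" for k
  proof -
    have "[:- \<alpha> i, 1:] * (?g ^ k * ?F ^ (l - k)) = ([:- \<alpha> i, 1:] * ?g) * ?g ^ (k - 1) * ?F ^ (l - k)"
      using that by (cases k) (simp_all only: power_Suc mult_ac diff_Suc_1 not_one_le_zero)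
    also have "\<dots> = ?g ^ (k - 1) * ?F ^ Suc (l - k)"
      unfolding psi_at_mult[OF z] by (simp only: power_Suc mult_ac)
    \<comment> \<open>Both bounds on \<open>k\<close> enter here, because subtraction
      truncates.\<close>
    also have "Suc (l - k) = l - (k - 1)"
      using that by simp
    finally show ?thesis
      unfolding x_def poly_mat_linear[OF B, symmetric] poly_mat_mult_vec[OF B U] by simp
  qed
  have "x 0 = 0\<^sub>v n"
    unfolding x_def using ul by (auto simp: hom_f)
  \<comment> \<open>\<open>x 1\<close> is g(A) applied to the image of f(A)^(l-1) u, a vector over K
    that is nonzero by the definition of the rank.\<close>
  moreover have "x 1 \<noteq> 0\<^sub>v n"
  proof
    assume "x 1 = 0\<^sub>v n"
    then have "poly_mat ?g ?B *\<^sub>v map_vec emb (poly_mat (f ^ (l - 1)) A *\<^sub>v u) = 0\<^sub>v n"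
      unfolding x_def hom_f[symmetric] poly_mat_mult_vec[OF B U] by simp
    then have "poly_mat (f ^ (l - 1)) A *\<^sub>v u = 0\<^sub>v n"
      using psi_at_mult_vec_eq_0[OF A _ assms(4,3) z]
        mult_mat_vec_carrier[OF poly_mat_carrier[OF A] u] by blast
    with ul1 show False ..
  qed
  ultimately have "jordan_chain ?B (\<alpha> i) l x"
    unfolding jordan_chain_def using l x_carrier step step[of 1] B by auto
  then show "jordan_chain ?B (\<alpha> i) l (\<lambda>k. eval_vec emb (p_vec f A l k u) (\<alpha> i))"
    unfolding eval_p_vec[OF assms(1) A u z] x_def .
qed

end
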